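(* Let $X$ be a set. The relations $\lhd$ and $\blacktriangleleft$ on the set $\mathrm{Pre}(X)$ of preorders on $X$ are partial orders. Moreover, for every preorder $P$ on $X$: (a) $(\underline P,\lhd)$ and $(\overline P,\blacktriangleleft)$ are partially ordered sets induced from $(\mathrm{Pre}(X),\preceq)$ (that is, on $\underline P$ the relation $\lhd$ coincides with $\preceq$, and on $\overline P$ the relation $\blacktriangleleft$ coincides with $\preceq$). (b) The preorders $P$ and $\mathbf b(P)=P\wedge P^{\mathrm{op}}$ are the unique maximal and minimal elements of $(\underline P,\lhd)$, respectively. The preorders $\mathbf c(P)=P\vee P^{\mathrm{op}}$ and $P$ are the unique maximal and minimal elements of $(\overline P,\blacktriangleleft)$, respectively. (c) When $X$ is finite, $(\underline P,\lhd)$ is a lattice with meet $\wedge$. The join of $R_1$ and $R_2$ is $G_P\big(F_P(R_1)\vee F_P(R_2)\big)=P\wedge(P^{\mathrm{op}}\vee R_1\vee R_2)$. (d) When $X$ is finite, $(\overline P,\blacktriangleleft)$ is a lattice with join $\vee$. The meet of $Q_1$ and $Q_2$ is $F_P\big(G_P(Q_1)\wedge G_P(Q_2)\big)=P\vee(P^{\mathrm{op}}\wedge Q_1\wedge Q_2)$.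
   Context: A preorder on $X$ is a reflexive transitive relation. $P\preceq Q$ means $x\le_Py\Rightarrow x\le_Qy$. $P^{\mathrm{op}}$ is the opposite preorder. $(\mathrm{Pre}(X),\preceq)$ is a lattice: the meet $P\wedge Q$ is the intersection of the relations, the join $P\vee Q$ is the transitive closure of their union. For a preorder $P$ define, for $R\preceq P$, $F_P(R)=P\vee R^{\mathrm{op}}$, and for $Q\succeq P$, $G_P(Q)=P\wedge Q^{\mathrm{op}}$. Define $R\lhd P$ (subdivision) if $R\preceq P$ and $R$ is in the image of $G_P$, equivalently $R=P\wedge(P^{\mathrm{op}}\vee R)$. Define $P\blacktriangleleft Q$ (contraction) if $P\preceq Q$ and $Q$ is in the image of $F_P$, equivalently $Q=P\vee(P^{\mathrm{op}}\wedge Q)$. $\underline P=\{R\in\mathrm{Pre}(X):R\lhd P\}$ and $\overline P=\{Q\in\mathrm{Pre}(X):P\blacktriangleleft Q\}$. *)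

theory Defs
  imports "HOL-Algebra.Lattice"
begin

text \<open>
  A preorder on \<open>X\<close> is a relation \<open>P \<subseteq> X \<times> X\<close> with \<open>preorder_on X P\<close>, and \<open>(x, y) \<in> P\<close> stands for
  \<open>x \<le>\<^sub>P y\<close>. Thus \<open>\<preceq>\<close> is \<open>\<subseteq>\<close>, the opposite preorder is \<open>P\<inverse>\<close>, and the meet is \<open>P \<inter> Q\<close>.
\<close>

definition Pre :: "'a set \<Rightarrow> 'a rel set" where
  "Pre X = {P. preorder_on X P}"

definition pre_join :: "'a rel \<Rightarrow> 'a rel \<Rightarrow> 'a rel"  (infixl \<open>\<squnion>\<^sub>p\<close> 65) where
  "P \<squnion>\<^sub>p Q = (P \<union> Q)\<^sup>+"

text \<open>
  \<open>pre_F P\<close> and \<open>pre_G P\<close> are total functions in HOL; mathematically \<open>pre_F P\<close> has domain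
  \<open>{R \<in> Pre X. R \<subseteq> P}\<close> and \<open>pre_G P\<close> has domain \<open>{Q \<in> Pre X. P \<subseteq> Q}\<close>. The images below are
  taken over these domains only.
\<close>

definition pre_F :: "'a rel \<Rightarrow> 'a rel \<Rightarrow> 'a rel" where
  "pre_F P R = P \<squnion>\<^sub>p R\<inverse>"

definition pre_G :: "'a rel \<Rightarrow> 'a rel \<Rightarrow> 'a rel" where
  "pre_G P Q = P \<inter> Q\<inverse>"

definition subdivision :: "'a set \<Rightarrow> 'a rel \<Rightarrow> 'a rel \<Rightarrow> bool" where
  "subdivision X R P \<longleftrightarrow>
     R \<in> Pre X \<and> P \<in> Pre X \<and> R \<subseteq> P \<and> R \<in> pre_G P ` {Q \<in> Pre X. P \<subseteq> Q}"

definition contraction :: "'a set \<Rightarrow> 'a rel \<Rightarrow> 'a rel \<Rightarrow> bool" where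
  "contraction X P Q \<longleftrightarrow>
     P \<in> Pre X \<and> Q \<in> Pre X \<and> P \<subseteq> Q \<and> Q \<in> pre_F P ` {R \<in> Pre X. R \<subseteq> P}"

definition subdivisions :: "'a set \<Rightarrow> 'a rel \<Rightarrow> 'a rel set" where
  "subdivisions X P = {R \<in> Pre X. subdivision X R P}"

definition contractions :: "'a set \<Rightarrow> 'a rel \<Rightarrow> 'a rel set" where
  "contractions X P = {Q \<in> Pre X. contraction X P Q}"

definition subdivision_order :: "'a set \<Rightarrow> 'a rel set \<Rightarrow> 'a rel gorder" where
  "subdivision_order X A = \<lparr>carrier = A, eq = (=), le = subdivision X\<rparr>"

definition contraction_order :: "'a set \<Rightarrow> 'a rel set \<Rightarrow> 'a rel gorder" where
  "contraction_order X A = \<lparr>carrier = A, eq = (=), le = contraction X\<rparr>"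

definition maximal_element :: "('b, 'c) gorder_scheme \<Rightarrow> 'b \<Rightarrow> bool" where
  "maximal_element L m \<longleftrightarrow> m \<in> carrier L \<and> (\<forall>x \<in> carrier L. m \<sqsubseteq>\<^bsub>L\<^esub> x \<longrightarrow> x = m)"

definition minimal_element :: "('b, 'c) gorder_scheme \<Rightarrow> 'b \<Rightarrow> bool" where
  "minimal_element L m \<longleftrightarrow> m \<in> carrier L \<and> (\<forall>x \<in> carrier L. x \<sqsubseteq>\<^bsub>L\<^esub> m \<longrightarrow> x = m)"

lemma Pre_converse [simp]: "P\<inverse> \<in> Pre X \<longleftrightarrow> P \<in> Pre X"
  by (simp add: Pre_def)

lemma Pre_inter: "P \<in> Pre X \<Longrightarrow> Q \<in> Pre X \<Longrightarrow> P \<inter> Q \<in> Pre X"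
  by (auto simp: Pre_def preorder_on_def refl_on_def intro: trans_Int)

lemma Pre_join:
  assumes "P \<in> Pre X" "Q \<in> Pre X"
  shows "P \<squnion>\<^sub>p Q \<in> Pre X"
proof -
  have "(P \<union> Q)\<^sup>+ \<subseteq> X \<times> X"
    using assms by (intro trancl_subset_Sigma) (auto simp: Pre_def preorder_on_def)
  then show ?thesis
    using assms by (auto simp: Pre_def preorder_on_def refl_on_def pre_join_def)
qed

lemma pre_join_upper: "P \<subseteq> P \<squnion>\<^sub>p Q" "Q \<subseteq> P \<squnion>\<^sub>p Q"
  by (auto simp: pre_join_def)

lemma pre_join_least:
  assumes "S \<in> Pre X" "P \<subseteq> S" "Q \<subseteq> S"
  shows "P \<squnion>\<^sub>p Q \<subseteq> S"
proof -
  have "(P \<union> Q)\<^sup>+ \<subseteq> S\<^sup>+"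
    using assms by (intro trancl_mono_subset) auto
  then show ?thesis
    using assms by (simp add: pre_join_def Pre_def preorder_on_def)
qed

lemma pre_join_converse: "(P \<squnion>\<^sub>p Q)\<inverse> = P\<inverse> \<squnion>\<^sub>p Q\<inverse>"
  by (simp add: pre_join_def trancl_converse[symmetric] converse_Un)

lemma subdivision_iff:
  assumes "P \<in> Pre X" "R \<in> Pre X" "R \<subseteq> P"
  shows "subdivision X R P \<longleftrightarrow> R = P \<inter> (P\<inverse> \<squnion>\<^sub>p R)"
proof
  assume "subdivision X R P"
  then obtain Q where Q: "Q \<in> Pre X" "P \<subseteq> Q" "R = P \<inter> Q\<inverse>"
    by (auto simp: subdivision_def pre_G_def)
  then have "P\<inverse> \<squnion>\<^sub>p R \<subseteq> Q\<inverse>"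
    by (intro pre_join_least[of _ X]) auto
  then show "R = P \<inter> (P\<inverse> \<squnion>\<^sub>p R)"
    using Q pre_join_upper(2)[of R "P\<inverse>"] by blast
next
  assume R: "R = P \<inter> (P\<inverse> \<squnion>\<^sub>p R)"
  have "R = pre_G P (pre_F P R)"
    using R by (simp add: pre_G_def pre_F_def pre_join_converse)
  moreover have "pre_F P R \<in> Pre X" "P \<subseteq> pre_F P R"
    using assms by (auto simp: pre_F_def Pre_join pre_join_upper)
  ultimately show "subdivision X R P"
    using assms by (auto simp: subdivision_def)
qed

lemma contraction_iff:
  assumes "P \<in> Pre X" "Q \<in> Pre X" "P \<subseteq> Q"
  shows "contraction X P Q \<longleftrightarrow> Q = P \<squnion>\<^sub>p (P\<inverse> \<inter> Q)"
proof
  assume "contraction X P Q"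
  then obtain R where R: "R \<in> Pre X" "R \<subseteq> P" "Q = P \<squnion>\<^sub>p R\<inverse>"
    by (auto simp: contraction_def pre_F_def)
  have "R\<inverse> \<subseteq> P\<inverse> \<inter> Q"
    using R pre_join_upper(2)[of "R\<inverse>" P] by auto
  then have "Q \<subseteq> P \<squnion>\<^sub>p (P\<inverse> \<inter> Q)"
    unfolding R(3) pre_join_def by (intro trancl_mono_subset) auto
  moreover have "P \<squnion>\<^sub>p (P\<inverse> \<inter> Q) \<subseteq> Q"
    using assms by (intro pre_join_least[of _ X]) auto
  ultimately show "Q = P \<squnion>\<^sub>p (P\<inverse> \<inter> Q)" by blast
next
  assume Q: "Q = P \<squnion>\<^sub>p (P\<inverse> \<inter> Q)"
  have "Q = pre_F P (pre_G P Q)"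
    using Q by (simp add: pre_G_def pre_F_def converse_Int)
  moreover have "pre_G P Q \<in> Pre X" "pre_G P Q \<subseteq> P"
    using assms by (auto simp: pre_G_def intro: Pre_inter)
  ultimately show "contraction X P Q"
    using assms by (auto simp: contraction_def)
qed

end

theory Submission
  imports Defs
begin

text \<open>
  Fix a preorder \<open>P\<close>. The map \<open>R \<mapsto> P \<inter> (P\<inverse> \<squnion>\<^sub>p R)\<close> is a closure operator on the preorders below \<open>P\<close>,
  and the subdivisions of \<open>P\<close> are its closed elements; dually \<open>Q \<mapsto> P \<squnion>\<^sub>p (P\<inverse> \<inter> Q)\<close> is an interior
  operator on the preorders above \<open>P\<close>, and the contractions of \<open>P\<close> are its open elements. This is
  the closure/interior pair of the Galois connection between \<open>pre_F P\<close> and \<open>pre_G P\<close>. Closed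
  elements are stable under meets, and the join of two of them is the closure of their join; dually
  for open elements. Every closure contains \<open>P \<inter> P\<inverse>\<close>, and \<open>P \<inter> P\<inverse>\<close> and \<open>P\<close> are themselves closed; every
  interior lies below \<open>P \<squnion>\<^sub>p P\<inverse>\<close>, and \<open>P\<close> and \<open>P \<squnion>\<^sub>p P\<inverse>\<close> are themselves open. This gives the extremal
  elements.

  A subdivision of \<open>P\<close> stays closed when \<open>P\<close> is replaced by a smaller preorder that still contains
  it, because the closure shrinks with \<open>P\<close>; so on the subdivisions of one \<open>P\<close> the relation \<open>\<lhd>\<close> is inclusion, and dually
  for \<open>\<blacktriangleleft>\<close>. Transitivity is not formal in this way, since there the ambient preorder grows. It rests
  on \<open>trancl_return\<close>: every edge of a closed walk can be retraced, by going once around the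
  rest of the walk. Suppose \<open>S \<lhd> R \<lhd> P\<close>. An element of \<open>P \<inter> (P\<inverse> \<squnion>\<^sub>p S)\<close> is witnessed by a walk with edges
  in \<open>P\<inverse>\<close> and \<open>S\<close> whose end is joined back to its start by an edge of \<open>P\<inverse>\<close>. The reverse of each of
  its \<open>P\<inverse>\<close>-edges then lies in \<open>P \<inter> (P\<inverse> \<squnion>\<^sub>p S) \<subseteq> P \<inter> (P\<inverse> \<squnion>\<^sub>p R) = R\<close>, so the walk in fact
  has its edges in \<open>R\<inverse>\<close> and \<open>S\<close>, and \<open>S \<lhd> R\<close> applies. Contractions are treated in the same way.
\<close>

section \<open>Collections of sets ordered by inclusion\<close>

text \<open>
  The orders on the subdivisions and on the contractions of a fixed preorder both turn out to be
  inclusion. Everything that concerns only the abstract order is settled here for both of them at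
  once. The relation is a parameter that agrees with inclusion on the carrier, because \<open>\<lhd>\<close> and
  \<open>\<blacktriangleleft>\<close> differ from inclusion elsewhere.
\<close>

lemma partial_order_by_inclusion:
  assumes "\<And>x y. x \<in> A \<Longrightarrow> y \<in> A \<Longrightarrow> r x y \<longleftrightarrow> x \<subseteq> y"
  shows "partial_order \<lparr>carrier = A, eq = (=), le = r\<rparr>"
  using assms by unfold_locales auto

lemma maximal_element_eq_top:
  assumes "\<And>x y. x \<in> A \<Longrightarrow> y \<in> A \<Longrightarrow> r x y \<longleftrightarrow> x \<subseteq> y"
    and "T \<in> A" "\<And>x. x \<in> A \<Longrightarrow> x \<subseteq> T"
  shows "maximal_element \<lparr>carrier = A, eq = (=), le = r\<rparr> M \<longleftrightarrow> M = T"
  using assms unfolding maximal_element_def by auto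

lemma minimal_element_eq_bottom:
  assumes "\<And>x y. x \<in> A \<Longrightarrow> y \<in> A \<Longrightarrow> r x y \<longleftrightarrow> x \<subseteq> y"
    and "B \<in> A" "\<And>x. x \<in> A \<Longrightarrow> B \<subseteq> x"
  shows "minimal_element \<lparr>carrier = A, eq = (=), le = r\<rparr> M \<longleftrightarrow> M = B"
  using assms unfolding minimal_element_def by auto

text \<open>
  Explicit formulas for the bounds of pairs are enough for a lattice, and antisymmetry identifies
  the lattice operations, which are defined by choice, with these formulas.
\<close>

lemma lattice_by_inclusion:
  fixes A :: "'b set set"
  assumes le: "\<forall>x\<in>A. \<forall>y\<in>A. r x y \<longleftrightarrow> x \<subseteq> y"
    and j: "\<forall>x\<in>A. \<forall>y\<in>A. j x y \<in> A \<and> x \<subseteq> j x y \<and> y \<subseteq> j x y"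
    and j_least: "\<forall>x\<in>A. \<forall>y\<in>A. \<forall>z\<in>A. x \<subseteq> z \<longrightarrow> y \<subseteq> z \<longrightarrow> j x y \<subseteq> z"
    and m: "\<forall>x\<in>A. \<forall>y\<in>A. m x y \<in> A \<and> m x y \<subseteq> x \<and> m x y \<subseteq> y"
    and m_greatest: "\<forall>x\<in>A. \<forall>y\<in>A. \<forall>z\<in>A. z \<subseteq> x \<longrightarrow> z \<subseteq> y \<longrightarrow> z \<subseteq> m x y"
  defines "L \<equiv> \<lparr>carrier = A, eq = (=), le = r\<rparr>"
  shows "lattice L"
    and "x \<in> A \<Longrightarrow> y \<in> A \<Longrightarrow> x \<squnion>\<^bsub>L\<^esub> y = j x y"
    and "x \<in> A \<Longrightarrow> y \<in> A \<Longrightarrow> x \<sqinter>\<^bsub>L\<^esub> y = m x y"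
proof -
  interpret partial_order L
    unfolding L_def by (rule partial_order_by_inclusion) (simp add: le)
  have lub: "is_lub L (j x y) {x, y}" if "x \<in> A" "y \<in> A" for x y
  proof -
    have "Upper L {x, y} = {u \<in> A. x \<subseteq> u \<and> y \<subseteq> u}"
      using that le by (auto simp: Upper_def L_def)
    then show ?thesis
      using that le j j_least by (simp add: least_def L_def)
  qed
  have glb: "is_glb L (m x y) {x, y}" if "x \<in> A" "y \<in> A" for x y
  proof -
    have "Lower L {x, y} = {l \<in> A. l \<subseteq> x \<and> l \<subseteq> y}"
      using that le by (auto simp: Lower_def L_def)
    then show ?thesis
      using that le m m_greatest by (simp add: greatest_def L_def)
  qed
  show "lattice L"
  proof unfold_locales
    show "\<exists>s. is_lub L s {x, y}" if "x \<in> carrier L" "y \<in> carrier L" for x y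
      using lub[of x y] that by (auto simp: L_def)
    show "\<exists>s. is_glb L s {x, y}" if "x \<in> carrier L" "y \<in> carrier L" for x y
      using glb[of x y] that by (auto simp: L_def)
  qed
  show "x \<squnion>\<^bsub>L\<^esub> y = j x y" if "x \<in> A" "y \<in> A"
    unfolding join_def sup_def
  proof (rule some_equality)
    show "is_lub L (j x y) {x, y}"
      using that by (rule lub)
    then show "s = j x y" if "is_lub L s {x, y}" for s
      using that by (meson le_antisym least_le least_mem least_closed)
  qed
  show "x \<sqinter>\<^bsub>L\<^esub> y = m x y" if "x \<in> A" "y \<in> A"
    unfolding meet_def inf_def
  proof (rule some_equality)
    show "is_glb L (m x y) {x, y}"
      using that by (rule glb)
    then show "s = m x y" if "is_glb L s {x, y}" for s
      using that by (meson le_antisym greatest_le greatest_mem greatest_closed)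
  qed
qed

section \<open>Subdivisions as closed elements, contractions as open elements\<close>

lemma pre_join_mono: "A \<subseteq> C \<Longrightarrow> B \<subseteq> D \<Longrightarrow> A \<squnion>\<^sub>p B \<subseteq> C \<squnion>\<^sub>p D"
  unfolding pre_join_def by (intro trancl_mono_subset) blast

text \<open>
  For preorders \<open>R \<subseteq> P \<subseteq> Q\<close> the inclusions \<open>R \<subseteq> P \<inter> (P\<inverse> \<squnion>\<^sub>p R)\<close> and \<open>P \<squnion>\<^sub>p (P\<inverse> \<inter> Q) \<subseteq> Q\<close> are
  automatic, so only the opposite ones have content. In this form closedness and openness can be
  read off by monotonicity.
\<close>

lemma subdivisions_iff:
  assumes "P \<in> Pre X"
  shows "R \<in> subdivisions X P \<longleftrightarrow> R \<in> Pre X \<and> R \<subseteq> P \<and> P \<inter> (P\<inverse> \<squnion>\<^sub>p R) \<subseteq> R"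
proof -
  have "R \<subseteq> P\<inverse> \<squnion>\<^sub>p R"
    by (rule pre_join_upper)
  then have "R = P \<inter> (P\<inverse> \<squnion>\<^sub>p R) \<longleftrightarrow> P \<inter> (P\<inverse> \<squnion>\<^sub>p R) \<subseteq> R" if "R \<subseteq> P"
    using that by blast
  then show ?thesis
    using subdivision_iff[OF assms, of R]
    by (auto simp: subdivisions_def subdivision_def[of X R P])
qed

lemma contractions_iff:
  assumes "P \<in> Pre X"
  shows "Q \<in> contractions X P \<longleftrightarrow> Q \<in> Pre X \<and> P \<subseteq> Q \<and> Q \<subseteq> P \<squnion>\<^sub>p (P\<inverse> \<inter> Q)"
proof -
  have "P \<squnion>\<^sub>p (P\<inverse> \<inter> Q) \<subseteq> Q" if "Q \<in> Pre X" "P \<subseteq> Q"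
    using that by (intro pre_join_least) auto
  then have "Q = P \<squnion>\<^sub>p (P\<inverse> \<inter> Q) \<longleftrightarrow> Q \<subseteq> P \<squnion>\<^sub>p (P\<inverse> \<inter> Q)" if "Q \<in> Pre X" "P \<subseteq> Q"
    using that by blast
  then show ?thesis
    using contraction_iff[OF assms, of Q]
    by (auto simp: contractions_def contraction_def[of X P Q])
qed

lemma subdivision_iff_mem: "subdivision X R P \<longleftrightarrow> P \<in> Pre X \<and> R \<in> subdivisions X P"
  by (auto simp: subdivisions_def subdivision_def)

lemma contraction_iff_mem: "contraction X P Q \<longleftrightarrow> P \<in> Pre X \<and> Q \<in> contractions X P"
  by (auto simp: contractions_def contraction_def)

text \<open>
  Shrinking the ambient preorder from \<open>P\<close> to \<open>R2\<close> shrinks the closure of \<open>R1\<close>, so \<open>R1\<close> stays closed.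
  Likewise enlarging it from \<open>P\<close> to \<open>Q1\<close> enlarges the interior of \<open>Q2\<close>.
\<close>

lemma subdivision_iff_subset:
  assumes P: "P \<in> Pre X" and R: "R1 \<in> subdivisions X P" "R2 \<in> subdivisions X P"
  shows "subdivision X R1 R2 \<longleftrightarrow> R1 \<subseteq> R2"
proof
  assume "R1 \<subseteq> R2"
  have "R2 \<in> Pre X" "R2 \<subseteq> P"
    using R by (auto simp: subdivisions_iff[OF P])
  moreover from \<open>R2 \<subseteq> P\<close> have "R2\<inverse> \<squnion>\<^sub>p R1 \<subseteq> P\<inverse> \<squnion>\<^sub>p R1"
    by (intro pre_join_mono) auto
  ultimately show "subdivision X R1 R2"
    using R \<open>R1 \<subseteq> R2\<close> unfolding subdivision_iff_mem subdivisions_iff[OF P]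
    by (subst subdivisions_iff) blast+
qed (simp add: subdivision_def)

lemma contraction_iff_subset:
  assumes P: "P \<in> Pre X" and Q: "Q1 \<in> contractions X P" "Q2 \<in> contractions X P"
  shows "contraction X Q1 Q2 \<longleftrightarrow> Q1 \<subseteq> Q2"
proof
  assume "Q1 \<subseteq> Q2"
  have "Q1 \<in> Pre X" "P \<subseteq> Q1"
    using Q by (auto simp: contractions_iff[OF P])
  moreover from \<open>P \<subseteq> Q1\<close> have "P \<squnion>\<^sub>p (P\<inverse> \<inter> Q2) \<subseteq> Q1 \<squnion>\<^sub>p (Q1\<inverse> \<inter> Q2)"
    by (intro pre_join_mono) auto
  ultimately show "contraction X Q1 Q2"
    using Q \<open>Q1 \<subseteq> Q2\<close> unfolding contraction_iff_mem contractions_iff[OF P]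
    by (subst contractions_iff) blast+
qed (simp add: contraction_def)

section \<open>Transitivity\<close>

text \<open>
  For a step of the walk from \<open>u\<close> to \<open>v\<close>, the relation \<open>T\<close> leads from \<open>v\<close> to \<open>y\<close>, back to \<open>x\<close>, and on
  to \<open>u\<close>. The induction keeps this true by closing each initial segment of the walk through its next
  edge.
\<close>

lemma trancl_return:
  assumes "(x, y) \<in> A\<^sup>+" "(y, x) \<in> T" "A \<subseteq> T" "trans T"
  shows "(x, y) \<in> (A \<inter> T\<inverse>)\<^sup>+"
  using assms(1,2)
proof (induction rule: trancl_induct)
  case (base z)
  then show ?case by auto
next
  case (step z w)
  have "(z, x) \<in> T"
    using step.hyps(2) step.prems assms(3,4) by (blast dest: transD)
  have "A\<^sup>+ \<subseteq> T"
    using trancl_mono_subset[OF assms(3)] assms(4) by simp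
  then have "(w, z) \<in> T"
    using step.hyps(1) step.prems assms(4) by (blast dest: transD)
  then have "(z, w) \<in> A \<inter> T\<inverse>"
    using step.hyps(2) by blast
  with step.IH[OF \<open>(z, x) \<in> T\<close>] show ?case
    by (rule trancl_into_trancl)
qed

lemma subdivision_trans:
  assumes "subdivision X S R" "subdivision X R P"
  shows "subdivision X S P"
proof -
  have P: "P \<in> Pre X" and R: "R \<in> Pre X" "R \<subseteq> P" "P \<inter> (P\<inverse> \<squnion>\<^sub>p R) \<subseteq> R"
    using assms(2) by (auto simp: subdivision_iff_mem subdivisions_iff)
  have S: "S \<in> Pre X" "S \<subseteq> R" "R \<inter> (R\<inverse> \<squnion>\<^sub>p S) \<subseteq> S"
    using assms(1) R(1) by (auto simp: subdivision_iff_mem subdivisions_iff)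
  let ?A = "P\<inverse> \<union> S"
  have A_R: "P \<inter> ?A\<^sup>+ \<subseteq> R"
    using pre_join_mono[OF order_refl S(2), of "P\<inverse>"] R(3) by (auto simp: pre_join_def)
  have "(x, y) \<in> S" if xy: "(x, y) \<in> P" "(x, y) \<in> ?A\<^sup>+" for x y
  proof -
    have "(x, y) \<in> (?A \<inter> (?A\<^sup>+)\<inverse>)\<^sup>+"
      using xy by (intro trancl_return) auto
    moreover have "?A \<inter> (?A\<^sup>+)\<inverse> \<subseteq> R\<inverse> \<union> S"
      using A_R by blast
    ultimately have "(x, y) \<in> R\<inverse> \<squnion>\<^sub>p S"
      unfolding pre_join_def using trancl_mono_subset by blast
    then show ?thesis
      using A_R xy S(3) by blast
  qed
  then show ?thesis
    using P R S by (auto simp: subdivision_iff_mem subdivisions_iff pre_join_def)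
qed

text \<open>
  An edge of \<open>T\<close> that reverses an element of \<open>Q\<close> closes up a walk with edges in \<open>P\<close> and
  \<open>P\<inverse> \<inter> Q\<close>. By \<open>trancl_return\<close> the walk can be retraced inside \<open>T\<close>: backwards, its \<open>P\<close>-edges become
  edges of \<open>P\<inverse> \<inter> T\<close> and its \<open>P\<inverse>\<close>-edges become edges of \<open>P\<close>.
\<close>

lemma contraction_trans:
  assumes "contraction X P Q" "contraction X Q T"
  shows "contraction X P T"
proof -
  have P: "P \<in> Pre X" and Q: "Q \<in> Pre X" "P \<subseteq> Q" "Q \<subseteq> P \<squnion>\<^sub>p (P\<inverse> \<inter> Q)"
    using assms(1) by (auto simp: contraction_iff_mem contractions_iff)
  have T: "T \<in> Pre X" "Q \<subseteq> T" "T \<subseteq> Q \<squnion>\<^sub>p (Q\<inverse> \<inter> T)"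
    using assms(2) Q(1) by (auto simp: contraction_iff_mem contractions_iff)
  let ?C = "P \<union> P\<inverse> \<inter> T"
  have "Q\<inverse> \<inter> T \<subseteq> ?C\<^sup>+"
  proof (rule subrelI)
    fix x y assume xy: "(x, y) \<in> Q\<inverse> \<inter> T"
    have "(y, x) \<in> ((P \<union> P\<inverse> \<inter> Q) \<inter> T\<inverse>)\<^sup>+"
      using xy Q T(1,2) by (intro trancl_return) (auto simp: pre_join_def Pre_def preorder_on_def)
    moreover have "(P \<union> P\<inverse> \<inter> Q) \<inter> T\<inverse> \<subseteq> ?C\<inverse>"
      by blast
    ultimately have "(y, x) \<in> (?C\<inverse>)\<^sup>+"
      using trancl_mono_subset by blast
    then show "(x, y) \<in> ?C\<^sup>+"
      by (simp add: trancl_converse)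
  qed
  moreover have "Q \<subseteq> ?C\<^sup>+"
    using Q(3) pre_join_mono[of P P "P\<inverse> \<inter> Q" "P\<inverse> \<inter> T"] T(2) by (auto simp: pre_join_def)
  ultimately have "(Q \<union> Q\<inverse> \<inter> T)\<^sup>+ \<subseteq> (?C\<^sup>+)\<^sup>+"
    by (intro trancl_mono_subset) blast
  then have "T \<subseteq> P \<squnion>\<^sub>p (P\<inverse> \<inter> T)"
    using T(3) by (auto simp: pre_join_def)
  then show ?thesis
    using P Q T by (auto simp: contraction_iff_mem contractions_iff)
qed

section \<open>Extremal elements\<close>

lemma self_subdivision: "P \<in> Pre X \<Longrightarrow> P \<in> subdivisions X P"
  by (auto simp: subdivisions_iff)

lemma self_contraction: "P \<in> Pre X \<Longrightarrow> P \<in> contractions X P"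
  by (auto simp: contractions_iff pre_join_upper)

text \<open>
  Since \<open>P \<inter> P\<inverse>\<close> already lies in \<open>P\<inverse>\<close>, joining it to \<open>P\<inverse>\<close> adds nothing; since \<open>P\<inverse>\<close> already lies in
  \<open>P \<squnion>\<^sub>p P\<inverse>\<close>, meeting the two removes nothing.
\<close>

lemma core_subdivision:
  assumes P: "P \<in> Pre X"
  shows "P \<inter> P\<inverse> \<in> subdivisions X P"
proof -
  have "P\<inverse> \<squnion>\<^sub>p (P \<inter> P\<inverse>) \<subseteq> P\<inverse>"
    using P by (intro pre_join_least) auto
  then show ?thesis
    using P by (auto simp: subdivisions_iff intro: Pre_inter)
qed

lemma core_subset_subdivision:
  assumes "P \<in> Pre X" "R \<in> subdivisions X P"
  shows "P \<inter> P\<inverse> \<subseteq> R"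
  using assms pre_join_upper(1)[of "P\<inverse>" R] by (auto simp: subdivisions_iff)

lemma components_contraction:
  assumes P: "P \<in> Pre X"
  shows "P \<squnion>\<^sub>p P\<inverse> \<in> contractions X P"
proof -
  have "P\<inverse> \<inter> (P \<squnion>\<^sub>p P\<inverse>) = P\<inverse>"
    using pre_join_upper(2)[of "P\<inverse>" P] by blast
  then show ?thesis
    using P by (auto simp: contractions_iff Pre_join pre_join_upper)
qed

lemma contraction_subset_components:
  assumes "P \<in> Pre X" "Q \<in> contractions X P"
  shows "Q \<subseteq> P \<squnion>\<^sub>p P\<inverse>"
  using assms pre_join_mono[of P P "P\<inverse> \<inter> Q" "P\<inverse>"] by (auto simp: contractions_iff)

section \<open>Meets and joins\<close>

lemma subdivisions_inter:
  assumes P: "P \<in> Pre X" and R: "R1 \<in> subdivisions X P" "R2 \<in> subdivisions X P"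
  shows "R1 \<inter> R2 \<in> subdivisions X P"
proof -
  have "P\<inverse> \<squnion>\<^sub>p (R1 \<inter> R2) \<subseteq> P\<inverse> \<squnion>\<^sub>p R1" "P\<inverse> \<squnion>\<^sub>p (R1 \<inter> R2) \<subseteq> P\<inverse> \<squnion>\<^sub>p R2"
    by (intro pre_join_mono; blast)+
  then show ?thesis
    using R by (auto simp: subdivisions_iff[OF P] intro: Pre_inter)
qed

text \<open>
  Each of \<open>Q1\<close> and \<open>Q2\<close> is generated by \<open>P\<close> and the elements of \<open>P\<inverse>\<close> that it contains. Their join contains
  both of these parts of \<open>P\<inverse>\<close>, so it is generated in the same way.
\<close>

lemma contractions_join:
  assumes P: "P \<in> Pre X" and Q: "Q1 \<in> contractions X P" "Q2 \<in> contractions X P"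
  shows "Q1 \<squnion>\<^sub>p Q2 \<in> contractions X P"
proof -
  let ?J = "Q1 \<squnion>\<^sub>p Q2"
  have Q': "Q1 \<in> Pre X" "Q2 \<in> Pre X" "P \<subseteq> Q1"
    using Q by (auto simp: contractions_iff[OF P])
  have J: "?J \<in> Pre X" "Q1 \<subseteq> ?J" "Q2 \<subseteq> ?J"
    using Q' by (auto simp: Pre_join pre_join_upper)
  have "P \<squnion>\<^sub>p (P\<inverse> \<inter> Q1) \<subseteq> P \<squnion>\<^sub>p (P\<inverse> \<inter> ?J)" "P \<squnion>\<^sub>p (P\<inverse> \<inter> Q2) \<subseteq> P \<squnion>\<^sub>p (P\<inverse> \<inter> ?J)"
    using J by (intro pre_join_mono; blast)+
  then have "Q1 \<subseteq> P \<squnion>\<^sub>p (P\<inverse> \<inter> ?J)" "Q2 \<subseteq> P \<squnion>\<^sub>p (P\<inverse> \<inter> ?J)"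
    using Q by (auto simp: contractions_iff[OF P])
  moreover have "P \<squnion>\<^sub>p (P\<inverse> \<inter> ?J) \<in> Pre X"
    using P J by (simp add: Pre_join Pre_inter)
  ultimately have "?J \<subseteq> P \<squnion>\<^sub>p (P\<inverse> \<inter> ?J)"
    by (intro pre_join_least)
  then show ?thesis
    using J Q' by (auto simp: contractions_iff[OF P])
qed

lemma pre_G_subdivision:
  assumes "P \<in> Pre X" "Q \<in> Pre X" "P \<subseteq> Q"
  shows "pre_G P Q \<in> subdivisions X P"
proof -
  have "pre_G P Q \<in> Pre X" "pre_G P Q \<subseteq> P"
    using assms by (auto simp: pre_G_def intro: Pre_inter)
  then show ?thesis
    using assms by (auto simp: subdivisions_def subdivision_def)
qed

lemma pre_F_contraction:
  assumes "P \<in> Pre X" "R \<in> Pre X" "R \<subseteq> P"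
  shows "pre_F P R \<in> contractions X P"
proof -
  have "pre_F P R \<in> Pre X" "P \<subseteq> pre_F P R"
    using assms by (auto simp: pre_F_def Pre_join pre_join_upper)
  then show ?thesis
    using assms by (auto simp: contractions_def contraction_def)
qed

lemma pre_G_join_pre_F:
  assumes P: "P \<in> Pre X" and R: "R1 \<in> Pre X" "R2 \<in> Pre X"
  shows "pre_G P (pre_F P R1 \<squnion>\<^sub>p pre_F P R2) = P \<inter> (P\<inverse> \<squnion>\<^sub>p R1 \<squnion>\<^sub>p R2)"
proof -
  let ?J = "P\<inverse> \<squnion>\<^sub>p R1 \<squnion>\<^sub>p R2"
  have J: "?J \<in> Pre X"
    using P R by (simp add: Pre_join)
  have "P\<inverse> \<squnion>\<^sub>p R1 \<subseteq> ?J" "R2 \<subseteq> ?J"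
    by (rule pre_join_upper)+
  moreover from this(1) have "P\<inverse> \<subseteq> ?J"
    using pre_join_upper(1)[of "P\<inverse>" R1] by blast
  ultimately have "P\<inverse> \<squnion>\<^sub>p R1 \<squnion>\<^sub>p (P\<inverse> \<squnion>\<^sub>p R2) \<subseteq> ?J"
    by (simp add: pre_join_least[OF J])
  moreover have "?J \<subseteq> P\<inverse> \<squnion>\<^sub>p R1 \<squnion>\<^sub>p (P\<inverse> \<squnion>\<^sub>p R2)"
    by (intro pre_join_mono order_refl pre_join_upper)
  ultimately show ?thesis
    by (auto simp: pre_G_def pre_F_def pre_join_converse)
qed

lemma pre_F_inter_pre_G:
  "pre_F P (pre_G P Q1 \<inter> pre_G P Q2) = P \<squnion>\<^sub>p (P\<inverse> \<inter> Q1 \<inter> Q2)"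
  unfolding pre_F_def pre_G_def by (intro arg_cong[where f = "(\<squnion>\<^sub>p) P"]) auto

lemma subdivisions_join_upper:
  assumes P: "P \<in> Pre X" and R: "R1 \<in> subdivisions X P" "R2 \<in> subdivisions X P"
  defines "J \<equiv> pre_G P (pre_F P R1 \<squnion>\<^sub>p pre_F P R2)"
  shows "J \<in> subdivisions X P \<and> R1 \<subseteq> J \<and> R2 \<subseteq> J"
proof -
  have R': "R1 \<in> Pre X" "R2 \<in> Pre X" "R1 \<subseteq> P" "R2 \<subseteq> P"
    using R by (auto simp: subdivisions_iff[OF P])
  let ?F = "pre_F P R1 \<squnion>\<^sub>p pre_F P R2"
  have F: "pre_F P R1 \<subseteq> ?F" "pre_F P R2 \<subseteq> ?F"
    by (rule pre_join_upper)+
  have "P \<subseteq> pre_F P R1" "R1\<inverse> \<subseteq> pre_F P R1" "R2\<inverse> \<subseteq> pre_F P R2"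
    unfolding pre_F_def by (rule pre_join_upper)+
  then have "P \<subseteq> ?F" "R1\<inverse> \<subseteq> ?F" "R2\<inverse> \<subseteq> ?F"
    using F by blast+
  moreover have "?F \<in> Pre X"
    using P R' by (simp add: pre_F_def Pre_join)
  ultimately show ?thesis
    using P R' by (auto simp: J_def pre_G_subdivision) (auto simp: pre_G_def)
qed

text \<open>
  The closure of the join of \<open>R1\<close> and \<open>R2\<close> lies inside the closure of \<open>R\<close>, which is \<open>R\<close>.
\<close>

lemma subdivisions_join_least:
  assumes P: "P \<in> Pre X"
    and R: "R1 \<in> subdivisions X P" "R2 \<in> subdivisions X P" "R \<in> subdivisions X P"
    and sub: "R1 \<subseteq> R" "R2 \<subseteq> R"
  shows "pre_G P (pre_F P R1 \<squnion>\<^sub>p pre_F P R2) \<subseteq> R"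
proof -
  have R': "R1 \<in> Pre X" "R2 \<in> Pre X" "R \<in> Pre X" "P \<inter> (P\<inverse> \<squnion>\<^sub>p R) \<subseteq> R"
    using R by (auto simp: subdivisions_iff[OF P])
  have J: "P\<inverse> \<squnion>\<^sub>p R \<in> Pre X"
    using P R' by (simp add: Pre_join)
  have "P\<inverse> \<squnion>\<^sub>p R1 \<subseteq> P\<inverse> \<squnion>\<^sub>p R"
    using sub by (intro pre_join_mono) auto
  moreover have "R2 \<subseteq> P\<inverse> \<squnion>\<^sub>p R"
    using sub pre_join_upper(2)[of R "P\<inverse>"] by blast
  ultimately have "P\<inverse> \<squnion>\<^sub>p R1 \<squnion>\<^sub>p R2 \<subseteq> P\<inverse> \<squnion>\<^sub>p R"
    by (simp add: pre_join_least[OF J])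
  then show ?thesis
    using R'(4) unfolding pre_G_join_pre_F[OF P R'(1,2)] by blast
qed

lemma contractions_meet_lower:
  assumes P: "P \<in> Pre X" and Q: "Q1 \<in> contractions X P" "Q2 \<in> contractions X P"
  defines "M \<equiv> pre_F P (pre_G P Q1 \<inter> pre_G P Q2)"
  shows "M \<in> contractions X P \<and> M \<subseteq> Q1 \<and> M \<subseteq> Q2"
proof -
  have Q': "Q1 \<in> Pre X" "Q2 \<in> Pre X" "P \<subseteq> Q1" "P \<subseteq> Q2"
    using Q by (auto simp: contractions_iff[OF P])
  have "pre_G P Q1 \<inter> pre_G P Q2 \<in> Pre X" "pre_G P Q1 \<inter> pre_G P Q2 \<subseteq> P"
    using P Q' by (auto simp: pre_G_def intro!: Pre_inter)
  then have "M \<in> contractions X P"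
    unfolding M_def by (rule pre_F_contraction[OF P])
  moreover have "M \<subseteq> Q1" "M \<subseteq> Q2"
    unfolding M_def pre_F_inter_pre_G
    using Q' pre_join_least[of Q1 X] pre_join_least[of Q2 X] by (simp_all add: le_infI1 le_infI2)
  ultimately show ?thesis by blast
qed

text \<open>
  Dually, \<open>Q\<close> is its own interior, which lies inside the interior of \<open>Q1 \<inter> Q2\<close>.
\<close>

lemma contractions_meet_greatest:
  assumes P: "P \<in> Pre X" and Q: "Q \<in> contractions X P" and sub: "Q \<subseteq> Q1" "Q \<subseteq> Q2"
  shows "Q \<subseteq> pre_F P (pre_G P Q1 \<inter> pre_G P Q2)"
proof -
  have "Q \<subseteq> P \<squnion>\<^sub>p (P\<inverse> \<inter> Q)"
    using Q by (auto simp: contractions_iff[OF P])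
  also have "\<dots> \<subseteq> P \<squnion>\<^sub>p (P\<inverse> \<inter> Q1 \<inter> Q2)"
    using sub by (intro pre_join_mono) auto
  finally show ?thesis
    unfolding pre_F_inter_pre_G .
qed

lemma lattice_subdivisions:
  assumes P: "P \<in> Pre X"
  defines "L \<equiv> subdivision_order X (subdivisions X P)"
  shows "lattice L"
    and "R1 \<in> subdivisions X P \<Longrightarrow> R2 \<in> subdivisions X P \<Longrightarrow>
      R1 \<squnion>\<^bsub>L\<^esub> R2 = pre_G P (pre_F P R1 \<squnion>\<^sub>p pre_F P R2)"
    and "R1 \<in> subdivisions X P \<Longrightarrow> R2 \<in> subdivisions X P \<Longrightarrow> R1 \<sqinter>\<^bsub>L\<^esub> R2 = R1 \<inter> R2"
proof -
  let ?A = "subdivisions X P" and ?j = "\<lambda>R1 R2. pre_G P (pre_F P R1 \<squnion>\<^sub>p pre_F P R2)"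
  have le: "\<forall>R1\<in>?A. \<forall>R2\<in>?A. subdivision X R1 R2 \<longleftrightarrow> R1 \<subseteq> R2"
    using subdivision_iff_subset[OF P] by blast
  have j: "\<forall>R1\<in>?A. \<forall>R2\<in>?A. ?j R1 R2 \<in> ?A \<and> R1 \<subseteq> ?j R1 R2 \<and> R2 \<subseteq> ?j R1 R2"
    using subdivisions_join_upper[OF P] by blast
  have j_least: "\<forall>R1\<in>?A. \<forall>R2\<in>?A. \<forall>R\<in>?A. R1 \<subseteq> R \<longrightarrow> R2 \<subseteq> R \<longrightarrow> ?j R1 R2 \<subseteq> R"
    using subdivisions_join_least[OF P] by simp
  have m: "\<forall>R1\<in>?A. \<forall>R2\<in>?A. R1 \<inter> R2 \<in> ?A \<and> R1 \<inter> R2 \<subseteq> R1 \<and> R1 \<inter> R2 \<subseteq> R2"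
    using subdivisions_inter[OF P] by simp
  have m_greatest: "\<forall>R1\<in>?A. \<forall>R2\<in>?A. \<forall>R\<in>?A. R \<subseteq> R1 \<longrightarrow> R \<subseteq> R2 \<longrightarrow> R \<subseteq> R1 \<inter> R2"
    by simp
  note lat = lattice_by_inclusion[OF le j j_least m m_greatest, folded subdivision_order_def L_def]
  show "lattice L"
    by (rule lat(1))
  show "R1 \<squnion>\<^bsub>L\<^esub> R2 = ?j R1 R2" if "R1 \<in> ?A" "R2 \<in> ?A"
    using that by (rule lat(2))
  show "R1 \<sqinter>\<^bsub>L\<^esub> R2 = R1 \<inter> R2" if "R1 \<in> ?A" "R2 \<in> ?A"
    using that by (rule lat(3))
qed

lemma lattice_contractions:
  assumes P: "P \<in> Pre X"
  defines "L \<equiv> contraction_order X (contractions X P)"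
  shows "lattice L"
    and "Q1 \<in> contractions X P \<Longrightarrow> Q2 \<in> contractions X P \<Longrightarrow> Q1 \<squnion>\<^bsub>L\<^esub> Q2 = Q1 \<squnion>\<^sub>p Q2"
    and "Q1 \<in> contractions X P \<Longrightarrow> Q2 \<in> contractions X P \<Longrightarrow>
      Q1 \<sqinter>\<^bsub>L\<^esub> Q2 = pre_F P (pre_G P Q1 \<inter> pre_G P Q2)"
proof -
  let ?A = "contractions X P" and ?m = "\<lambda>Q1 Q2. pre_F P (pre_G P Q1 \<inter> pre_G P Q2)"
  have le: "\<forall>Q1\<in>?A. \<forall>Q2\<in>?A. contraction X Q1 Q2 \<longleftrightarrow> Q1 \<subseteq> Q2"
    using contraction_iff_subset[OF P] by blast
  have j: "\<forall>Q1\<in>?A. \<forall>Q2\<in>?A. Q1 \<squnion>\<^sub>p Q2 \<in> ?A \<and> Q1 \<subseteq> Q1 \<squnion>\<^sub>p Q2 \<and> Q2 \<subseteq> Q1 \<squnion>\<^sub>p Q2"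
    by (simp add: contractions_join[OF P] pre_join_upper)
  have j_least: "\<forall>Q1\<in>?A. \<forall>Q2\<in>?A. \<forall>Q\<in>?A. Q1 \<subseteq> Q \<longrightarrow> Q2 \<subseteq> Q \<longrightarrow> Q1 \<squnion>\<^sub>p Q2 \<subseteq> Q"
    by (simp add: contractions_def pre_join_least[of _ X])
  have m: "\<forall>Q1\<in>?A. \<forall>Q2\<in>?A. ?m Q1 Q2 \<in> ?A \<and> ?m Q1 Q2 \<subseteq> Q1 \<and> ?m Q1 Q2 \<subseteq> Q2"
    using contractions_meet_lower[OF P] by blast
  have m_greatest: "\<forall>Q1\<in>?A. \<forall>Q2\<in>?A. \<forall>Q\<in>?A. Q \<subseteq> Q1 \<longrightarrow> Q \<subseteq> Q2 \<longrightarrow> Q \<subseteq> ?m Q1 Q2"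
    using contractions_meet_greatest[OF P] by simp
  note lat = lattice_by_inclusion[OF le j j_least m m_greatest, folded contraction_order_def L_def]
  show "lattice L"
    by (rule lat(1))
  show "Q1 \<squnion>\<^bsub>L\<^esub> Q2 = Q1 \<squnion>\<^sub>p Q2" if "Q1 \<in> ?A" "Q2 \<in> ?A"
    using that by (rule lat(2))
  show "Q1 \<sqinter>\<^bsub>L\<^esub> Q2 = ?m Q1 Q2" if "Q1 \<in> ?A" "Q2 \<in> ?A"
    using that by (rule lat(3))
qed

section \<open>The structure of the two orders\<close>

lemma partial_order_subdivision: "partial_order (subdivision_order X (Pre X))"
  unfolding subdivision_order_def
proof (unfold_locales, unfold partial_object.select_convs eq_object.select_convs gorder.select_convs)
  show "subdivision X P P" if "P \<in> Pre X" for P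
    using that by (simp add: subdivision_iff_mem self_subdivision)
  show "subdivision X P S" if "subdivision X P Q" "subdivision X Q S" for P Q S
    using that by (rule subdivision_trans)
qed (auto simp: subdivision_def)

lemma partial_order_contraction: "partial_order (contraction_order X (Pre X))"
  unfolding contraction_order_def
proof (unfold_locales, unfold partial_object.select_convs eq_object.select_convs gorder.select_convs)
  show "contraction X P P" if "P \<in> Pre X" for P
    using that by (simp add: contraction_iff_mem self_contraction)
  show "contraction X P S" if "contraction X P Q" "contraction X Q S" for P Q S
    using that by (rule contraction_trans)
qed (auto simp: contraction_def)

theorem theorem6p11:
  fixes X :: "'a set"
  shows "partial_order (subdivision_order X (Pre X)) \<and>
    partial_order (contraction_order X (Pre X)) \<and>
    (\<forall>P \<in> Pre X.
      \<comment> \<open>(a)\<close>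
      (partial_order (subdivision_order X (subdivisions X P)) \<and>
       (\<forall>R1 \<in> subdivisions X P. \<forall>R2 \<in> subdivisions X P. subdivision X R1 R2 \<longleftrightarrow> R1 \<subseteq> R2) \<and>
       partial_order (contraction_order X (contractions X P)) \<and>
       (\<forall>Q1 \<in> contractions X P. \<forall>Q2 \<in> contractions X P. contraction X Q1 Q2 \<longleftrightarrow> Q1 \<subseteq> Q2)) \<and>
      \<comment> \<open>(b)\<close>
      ((\<forall>M. maximal_element (subdivision_order X (subdivisions X P)) M \<longleftrightarrow> M = P) \<and>
       (\<forall>M. minimal_element (subdivision_order X (subdivisions X P)) M \<longleftrightarrow> M = P \<inter> P\<inverse>) \<and>
       (\<forall>M. maximal_element (contraction_order X (contractions X P)) M \<longleftrightarrow> M = P \<squnion>\<^sub>p P\<inverse>) \<and>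
       (\<forall>M. minimal_element (contraction_order X (contractions X P)) M \<longleftrightarrow> M = P)) \<and>
      \<comment> \<open>(c)\<close>
      (finite X \<longrightarrow>
         lattice (subdivision_order X (subdivisions X P)) \<and>
         (\<forall>R1 \<in> subdivisions X P. \<forall>R2 \<in> subdivisions X P.
            R1 \<sqinter>\<^bsub>subdivision_order X (subdivisions X P)\<^esub> R2 = R1 \<inter> R2 \<and>
            R1 \<squnion>\<^bsub>subdivision_order X (subdivisions X P)\<^esub> R2 = pre_G P (pre_F P R1 \<squnion>\<^sub>p pre_F P R2) \<and>
            pre_G P (pre_F P R1 \<squnion>\<^sub>p pre_F P R2) = P \<inter> (P\<inverse> \<squnion>\<^sub>p R1 \<squnion>\<^sub>p R2))) \<and>
      \<comment> \<open>(d)\<close>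
      (finite X \<longrightarrow>
         lattice (contraction_order X (contractions X P)) \<and>
         (\<forall>Q1 \<in> contractions X P. \<forall>Q2 \<in> contractions X P.
            Q1 \<squnion>\<^bsub>contraction_order X (contractions X P)\<^esub> Q2 = Q1 \<squnion>\<^sub>p Q2 \<and>
            Q1 \<sqinter>\<^bsub>contraction_order X (contractions X P)\<^esub> Q2 = pre_F P (pre_G P Q1 \<inter> pre_G P Q2) \<and>
            pre_F P (pre_G P Q1 \<inter> pre_G P Q2) = P \<squnion>\<^sub>p (P\<inverse> \<inter> Q1 \<inter> Q2))))"
proof (intro conjI ballI impI)
  show "partial_order (subdivision_order X (Pre X))"
    by (rule partial_order_subdivision)
  show "partial_order (contraction_order X (Pre X))"
    by (rule partial_order_contraction)
next
  fix P assume P: "P \<in> Pre X"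
  note sub = subdivision_iff_subset[OF P] and con = contraction_iff_subset[OF P]
  show "partial_order (subdivision_order X (subdivisions X P))"
    unfolding subdivision_order_def by (rule partial_order_by_inclusion) (rule sub)
  show "partial_order (contraction_order X (contractions X P))"
    unfolding contraction_order_def by (rule partial_order_by_inclusion) (rule con)
  show "\<forall>M. maximal_element (subdivision_order X (subdivisions X P)) M \<longleftrightarrow> M = P"
    unfolding subdivision_order_def
    by (intro allI maximal_element_eq_top sub self_subdivision[OF P])
      (simp_all add: subdivisions_def subdivision_def)
  show "\<forall>M. minimal_element (subdivision_order X (subdivisions X P)) M \<longleftrightarrow> M = P \<inter> P\<inverse>"
    unfolding subdivision_order_def
    by (intro allI minimal_element_eq_bottom sub core_subdivision[OF P]
        core_subset_subdivision[OF P])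
  show "\<forall>M. maximal_element (contraction_order X (contractions X P)) M \<longleftrightarrow> M = P \<squnion>\<^sub>p P\<inverse>"
    unfolding contraction_order_def
    by (intro allI maximal_element_eq_top con components_contraction[OF P]
        contraction_subset_components[OF P])
  show "\<forall>M. minimal_element (contraction_order X (contractions X P)) M \<longleftrightarrow> M = P"
    unfolding contraction_order_def
    by (intro allI minimal_element_eq_bottom con self_contraction[OF P])
      (simp_all add: contractions_def contraction_def)
  show "lattice (subdivision_order X (subdivisions X P))"
    by (rule lattice_subdivisions[OF P])
  show "lattice (contraction_order X (contractions X P))"
    by (rule lattice_contractions[OF P])
  fix R1 R2 assume R: "R1 \<in> subdivisions X P" "R2 \<in> subdivisions X P"
  show "subdivision X R1 R2 \<longleftrightarrow> R1 \<subseteq> R2"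
    using R by (rule sub)
  show "R1 \<sqinter>\<^bsub>subdivision_order X (subdivisions X P)\<^esub> R2 = R1 \<inter> R2"
    using R by (rule lattice_subdivisions[OF P])
  show "R1 \<squnion>\<^bsub>subdivision_order X (subdivisions X P)\<^esub> R2 = pre_G P (pre_F P R1 \<squnion>\<^sub>p pre_F P R2)"
    using R by (rule lattice_subdivisions[OF P])
  show "pre_G P (pre_F P R1 \<squnion>\<^sub>p pre_F P R2) = P \<inter> (P\<inverse> \<squnion>\<^sub>p R1 \<squnion>\<^sub>p R2)"
    using R by (intro pre_G_join_pre_F[OF P]) (auto simp: subdivisions_def)
next
  fix P Q1 Q2
  assume P: "P \<in> Pre X" and Q: "Q1 \<in> contractions X P" "Q2 \<in> contractions X P"
  show "contraction X Q1 Q2 \<longleftrightarrow> Q1 \<subseteq> Q2"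
    using Q by (rule contraction_iff_subset[OF P])
  show "Q1 \<squnion>\<^bsub>contraction_order X (contractions X P)\<^esub> Q2 = Q1 \<squnion>\<^sub>p Q2"
    using Q by (rule lattice_contractions[OF P])
  show "Q1 \<sqinter>\<^bsub>contraction_order X (contractions X P)\<^esub> Q2 = pre_F P (pre_G P Q1 \<inter> pre_G P Q2)"
    using Q by (rule lattice_contractions[OF P])
  show "pre_F P (pre_G P Q1 \<inter> pre_G P Q2) = P \<squnion>\<^sub>p (P\<inverse> \<inter> Q1 \<inter> Q2)"
    by (rule pre_F_inter_pre_G)
qed

end
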